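(* Let $(\mathbb{X},\oplus,\otimes,\mathbb{0},\mathbb{1})$ be a linearly ordered radicable idempotent semifield, let $n\geq 1$, let $\mathbf{p}\in\mathbb{X}^{n}$ be a nonzero vector, $\mathbf{q}\in\mathbb{X}^{n}$ a regular vector, and $\Delta=\mathbf{q}^{-}\mathbf{p}$. Then the following two sets of regular vectors $\mathbf{x}\in\mathbb{X}^{n}$ are the same: (i) the set of regular $\mathbf{x}$ such that $\alpha\mathbf{p}\leq\mathbf{x}\leq\alpha\Delta\mathbf{q}$ for some scalar $\alpha>\mathbb{0}$; (ii) the set of regular $\mathbf{x}$ such that $\mathbf{x}=(\mathbf{I}\oplus\Delta^{-1}\mathbf{p}\mathbf{q}^{-})\mathbf{u}$ for some vector $\mathbf{u}\in\mathbb{X}^{n}$ with $\mathbf{u}>\mathbf{0}$ (all components $>\mathbb{0}$).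
   Context: Idempotent semifield: $\mathbb{X}$ is a set with two associative and commutative operations $\oplus$ (addition) and $\otimes$ (multiplication, sign usually omitted) with neutral elements $\mathbb{0}$ and $\mathbb{1}$ respectively; addition is idempotent ($x\oplus x=x$), multiplication distributes over addition, and each $x\neq\mathbb{0}$ has a multiplicative inverse $x^{-1}$ (and $\mathbb{0}$ is absorbing for multiplication). The order is defined by $x\leq y$ iff $x\oplus y=y$ and is assumed linear, so $x\oplus y=\max(x,y)$. Radicable means that $x^{m}=a$ has a solution for every $a\neq\mathbb{0}$ and every integer $m\geq1$. Vectors and matrices: vectors in $\mathbb{X}^{n}$ are column vectors; matrix/vector operations follow the usual rules with $\oplus,\otimes$ in place of ordinary addition and multiplication; inequalities are componentwise. $\mathbf{0}$ is the vector with all entries $\mathbb{0}$. $\mathbf{I}$ is the identity matrix ($\mathbb{1}$ on the diagonal, $\mathbb{0}$ elsewhere). A vector is nonzero if it has at least one entry $\neq\mathbb{0}$, and regular if none of its entries is $\mathbb{0}$. For a nonzero column vector $\mathbf{x}=(x_{i})$, the multiplicative conjugate transpose is the row vector $\mathbf{x}^{-}=(x_{i}^{-})$ with $x_{i}^{-}=x_{i}^{-1}$ if $x_{i}\neq\mathbb{0}$ and $x_{i}^{-}=\mathbb{0}$ otherwise. *)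

theory Defs
  imports "HOL-Analysis.Cartesian_Space"
begin

text \<open>
  The ring signature is used for the semifield operations: \<open>+\<close>, \<open>*\<close>, \<open>0\<close>, \<open>1\<close> are the
  idempotent addition, the multiplication and their neutral elements, so that
  \<open>\<Sum>\<close>, \<open>**\<close>, \<open>*v\<close> and \<open>*s\<close> are the operations over the semifield. The class
  \<^class>\<open>comm_semiring_1\<close> includes \<open>0 \<noteq> 1\<close>; this only excludes the one-element structure,
  which has no nonzero vectors. The value of \<open>inverse 0\<close> is left unspecified.
\<close>

class idempotent_semifield = comm_semiring_1 + inverse +
  assumes add_idem: "x + x = x"
    and left_inverse_semifield: "x \<noteq> 0 \<Longrightarrow> inverse x * x = 1"
    and divide_inverse_semifield: "x / y = x * inverse y"

class linordered_idempotent_semifield = idempotent_semifield + linorder +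
  assumes le_iff_add_eq: "x \<le> y \<longleftrightarrow> x + y = y"

class radicable_linordered_idempotent_semifield = linordered_idempotent_semifield +
  assumes radicable: "a \<noteq> 0 \<Longrightarrow> 1 \<le> m \<Longrightarrow> \<exists>x. x ^ m = a"

definition regular :: "'a::zero ^ 'n \<Rightarrow> bool" where
  "regular x \<longleftrightarrow> (\<forall>i. x $ i \<noteq> 0)"

text \<open>The library's \<open><\<close> on vectors is the strict part of \<open>\<le>\<close>, not the componentwise strict order.\<close>

definition vec_less :: "'a::ord ^ 'n \<Rightarrow> 'a ^ 'n \<Rightarrow> bool" where
  "vec_less x y \<longleftrightarrow> (\<forall>i. x $ i < y $ i)"

text \<open>Row vectors are matrices with a single row.\<close>

definition conj_transpose :: "'a::idempotent_semifield ^ 'n \<Rightarrow> 'a ^ 'n ^ 1" where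
  "conj_transpose x = rowvector (\<chi> i. if x $ i \<noteq> 0 then inverse (x $ i) else 0)"

definition scalar_matrix_mult :: "'a::times \<Rightarrow> 'a ^ 'n ^ 'm \<Rightarrow> 'a ^ 'n ^ 'm"  (infixr \<open>*sm\<close> 75) where
  "c *sm A = (\<chi> i j. c * A $ i $ j)"

end

theory Submission
  imports Defs
begin

text \<open>
  Write \<open>s = q\<^sup>- u\<close>. Since \<open>(I \<oplus> \<Delta>\<^sup>-\<^sup>1 p q\<^sup>-) u = u \<oplus> \<Delta>\<^sup>-\<^sup>1 s p\<close> (lemma \<open>kernel_matrix_component\<close>),
  every such vector satisfies the double inequality with \<open>\<alpha> = \<Delta>\<^sup>-\<^sup>1 s\<close>: the lower bound is the second
  summand, and the upper bound \<open>\<alpha> \<Delta> q = s q\<close> dominates both summands, because \<open>u \<le> (q\<^sup>- u) q\<close>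
  holds for every \<open>u\<close> and \<open>p \<le> \<Delta> q\<close> is its instance for \<open>u = p\<close> (lemma \<open>le_conj_transpose_mult\<close>).
  Conversely, the matrix fixes every solution \<open>x\<close> of the double inequality, so that \<open>u = x\<close> serves as
  parameter: \<open>x \<le> \<alpha> \<Delta> q\<close> means \<open>q\<^sup>- x \<le> \<alpha> \<Delta>\<close> (the residuation lemma
  \<open>conj_transpose_mult_le\<close>), hence \<open>\<Delta>\<^sup>-\<^sup>1 (q\<^sup>- x) p \<le> \<alpha> p \<le> x\<close>, and adding a smaller vector to \<open>x\<close>
  leaves \<open>x\<close> unchanged.
\<close>

section \<open>Order and arithmetic in a linearly ordered idempotent semifield\<close>

lemma semifield_zero_le: "(0::'a::linordered_idempotent_semifield) \<le> x"
  by (simp add: le_iff_add_eq)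

lemma semifield_zero_less_iff: "(0::'a::linordered_idempotent_semifield) < x \<longleftrightarrow> x \<noteq> 0"
  using semifield_zero_le[of x] by (auto simp: less_le)

lemma semifield_le_add1: "(a::'a::linordered_idempotent_semifield) \<le> a + b"
  by (simp add: le_iff_add_eq add.assoc[symmetric] add_idem)

lemma semifield_le_add2: "(b::'a::linordered_idempotent_semifield) \<le> a + b"
  by (metis add.commute semifield_le_add1)

lemma semifield_add_le:
  fixes a b c :: "'a::linordered_idempotent_semifield"
  assumes "a \<le> c" "b \<le> c"
  shows "a + b \<le> c"
  using assms by (simp add: le_iff_add_eq add.assoc)

lemma semifield_mult_left_mono:
  fixes a b c :: "'a::linordered_idempotent_semifield"
  assumes "a \<le> b"
  shows "c * a \<le> c * b"
  using assms by (simp add: le_iff_add_eq distrib_left[symmetric])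

lemma semifield_right_inverse:
  "(x::'a::idempotent_semifield) \<noteq> 0 \<Longrightarrow> x * inverse x = 1"
  by (metis left_inverse_semifield mult.commute)

lemma semifield_inverse_nonzero:
  "(x::'a::idempotent_semifield) \<noteq> 0 \<Longrightarrow> inverse x \<noteq> 0"
  by (metis left_inverse_semifield mult_zero_left zero_neq_one)

lemma semifield_mult_nonzero:
  fixes x y :: "'a::idempotent_semifield"
  assumes "x \<noteq> 0" "y \<noteq> 0"
  shows "x * y \<noteq> 0"
  by (metis assms left_inverse_semifield mult.assoc mult.left_neutral mult_zero_right)

lemma semifield_le_sum:
  fixes f :: "'b \<Rightarrow> 'a::linordered_idempotent_semifield"
  assumes "finite A" "i \<in> A"
  shows "f i \<le> sum f A"
  using assms by (simp add: sum.remove semifield_le_add1)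

lemma semifield_sum_le:
  fixes f :: "'b \<Rightarrow> 'a::linordered_idempotent_semifield"
  assumes "\<And>i. i \<in> A \<Longrightarrow> f i \<le> c"
  shows "sum f A \<le> c"
  using assms
  by (induction A rule: infinite_finite_induct) (auto intro: semifield_add_le semifield_zero_le)

section \<open>The product of a conjugate transpose and a vector\<close>

lemma conj_transpose_mult:
  fixes q u :: "'a::idempotent_semifield ^ 'n::finite"
  assumes "regular q"
  shows "(conj_transpose q *v u) $ 1 = (\<Sum>j\<in>UNIV. inverse (q $ j) * u $ j)"
  using assms by (simp add: conj_transpose_def rowvector_def matrix_vector_mult_def regular_def)

text \<open>
  The next two lemmas are the two halves of the Galois connection between \<open>u \<mapsto> q\<^sup>- u\<close> and
  \<open>c \<mapsto> c q\<close>. The first is its unit: the sum \<open>q\<^sup>- u\<close> is a maximum, hence bounds each quotient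
  \<open>q\<^sub>i\<^sup>-\<^sup>1 u\<^sub>i\<close>. The second says that it is the least such bound.
\<close>

lemma le_conj_transpose_mult:
  fixes q u :: "'a::linordered_idempotent_semifield ^ 'n::finite"
  assumes "regular q"
  shows "u $ i \<le> (conj_transpose q *v u) $ 1 * q $ i"
proof -
  have "u $ i = q $ i * (inverse (q $ i) * u $ i)"
    using assms by (simp add: mult.assoc[symmetric] semifield_right_inverse regular_def)
  also have "\<dots> \<le> q $ i * (\<Sum>j\<in>UNIV. inverse (q $ j) * u $ j)"
    by (intro semifield_mult_left_mono semifield_le_sum) auto
  finally show ?thesis
    by (simp add: conj_transpose_mult[OF assms] mult.commute)
qed

lemma conj_transpose_mult_le:
  fixes q u :: "'a::linordered_idempotent_semifield ^ 'n::finite"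
  assumes q: "regular q" and u: "\<And>i. u $ i \<le> c * q $ i"
  shows "(conj_transpose q *v u) $ 1 \<le> c"
  unfolding conj_transpose_mult[OF q]
proof (rule semifield_sum_le)
  fix j
  have "inverse (q $ j) * u $ j \<le> inverse (q $ j) * (c * q $ j)"
    by (intro semifield_mult_left_mono u)
  also have "\<dots> = c * (inverse (q $ j) * q $ j)"
    by (simp add: ac_simps)
  also have "\<dots> = c"
    using q by (simp add: left_inverse_semifield regular_def)
  finally show "inverse (q $ j) * u $ j \<le> c" .
qed

text \<open>Otherwise \<open>u \<le> (q\<^sup>- u) q\<close> would force \<open>u\<close> below zero, the least element.\<close>

lemma conj_transpose_mult_nonzero:
  fixes q u :: "'a::linordered_idempotent_semifield ^ 'n::finite"
  assumes "regular q" "u \<noteq> 0"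
  shows "(conj_transpose q *v u) $ 1 \<noteq> 0"
proof
  assume "(conj_transpose q *v u) $ 1 = 0"
  then have "u $ i \<le> 0" for i
    using le_conj_transpose_mult[OF assms(1), of u i] by simp
  then have "u = 0"
    by (simp add: vec_eq_iff antisym semifield_zero_le)
  with assms(2) show False ..
qed

lemma kernel_matrix_component:
  fixes p q u :: "'a::idempotent_semifield ^ 'n::finite"
  shows "((mat 1 + c *sm (columnvector p ** conj_transpose q)) *v u) $ i =
           u $ i + c * (conj_transpose q *v u) $ 1 * p $ i"
proof -
  have "((c *sm (columnvector p ** conj_transpose q)) *v u) $ i =
          c * (conj_transpose q *v u) $ 1 * p $ i"
    by (simp add: scalar_matrix_mult_def matrix_matrix_mult_def matrix_vector_mult_def
        columnvector_def sum_distrib_left sum_distrib_right ac_simps)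
  then show ?thesis
    by (simp add: matrix_vector_mult_add_rdistrib)
qed

section \<open>The two descriptions of the solution set\<close>

theorem mainTheorem3:
  fixes p q :: "'a::radicable_linordered_idempotent_semifield ^ 'n"
    and \<Delta> :: 'a
  assumes "p \<noteq> 0"
    and "regular q"
    and "\<Delta> = (conj_transpose q *v p) $ 1"
  shows "{x. regular x \<and> (\<exists>\<alpha>. \<alpha> > 0 \<and> \<alpha> *s p \<le> x \<and> x \<le> (\<alpha> * \<Delta>) *s q)} =
         {x. regular x \<and>
             (\<exists>u. vec_less 0 u \<and>
                  x = (mat 1 + inverse \<Delta> *sm (columnvector p ** conj_transpose q)) *v u)}"
proof -
  let ?K = "mat 1 + inverse \<Delta> *sm (columnvector p ** conj_transpose q)"
  have \<Delta>: "\<Delta> \<noteq> 0"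
    using conj_transpose_mult_nonzero[OF assms(2,1)] assms(3) by simp
  have "\<exists>u. vec_less 0 u \<and> x = ?K *v u"
    if "regular x" "\<alpha> *s p \<le> x" "x \<le> (\<alpha> * \<Delta>) *s q" for x \<alpha>
  proof (intro exI conjI)
    show "vec_less 0 x"
      using that(1) by (simp add: vec_less_def regular_def semifield_zero_less_iff)
    let ?s = "(conj_transpose q *v x) $ 1"
    have s: "?s \<le> \<alpha> * \<Delta>"
      using that(3) by (intro conj_transpose_mult_le assms(2)) (simp add: less_eq_vec_def)
    show "x = ?K *v x"
    proof (simp only: vec_eq_iff kernel_matrix_component, rule allI)
      fix i
      have "(inverse \<Delta> * p $ i) * ?s \<le> (inverse \<Delta> * p $ i) * (\<alpha> * \<Delta>)"
        by (intro semifield_mult_left_mono s)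
      also have "\<dots> = \<alpha> * p $ i * (inverse \<Delta> * \<Delta>)"
        by (simp add: ac_simps)
      also have "\<dots> = \<alpha> * p $ i"
        by (simp add: left_inverse_semifield \<Delta>)
      also have "\<dots> \<le> x $ i"
        using that(2) by (simp add: less_eq_vec_def)
      finally show "x $ i = x $ i + inverse \<Delta> * ?s * p $ i"
        by (simp add: le_iff_add_eq ac_simps)
    qed
  qed
  moreover have "\<exists>\<alpha>. \<alpha> > 0 \<and> \<alpha> *s p \<le> ?K *v u \<and> ?K *v u \<le> (\<alpha> * \<Delta>) *s q"
    if "vec_less 0 u" for u
  proof -
    let ?s = "(conj_transpose q *v u) $ 1"
    let ?\<alpha> = "inverse \<Delta> * ?s"
    have "u \<noteq> 0"
      using that by (auto simp: vec_less_def)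
    then have "?\<alpha> > 0"
      by (simp add: semifield_zero_less_iff semifield_mult_nonzero semifield_inverse_nonzero
          \<Delta> conj_transpose_mult_nonzero assms(2))
    moreover have "?\<alpha> *s p \<le> ?K *v u"
      by (simp add: less_eq_vec_def kernel_matrix_component semifield_le_add2)
    moreover have "u $ i + ?\<alpha> * p $ i \<le> ?\<alpha> * \<Delta> * q $ i" for i
    proof (rule semifield_add_le)
      have "u $ i \<le> ?s * q $ i"
        by (rule le_conj_transpose_mult[OF assms(2)])
      also have "\<dots> = (inverse \<Delta> * \<Delta>) * (?s * q $ i)"
        by (simp add: left_inverse_semifield \<Delta>)
      also have "\<dots> = ?\<alpha> * \<Delta> * q $ i"
        by (simp only: ac_simps)
      finally show "u $ i \<le> ?\<alpha> * \<Delta> * q $ i" .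
      have "p $ i \<le> \<Delta> * q $ i"
        unfolding assms(3) by (rule le_conj_transpose_mult[OF assms(2)])
      then show "?\<alpha> * p $ i \<le> ?\<alpha> * \<Delta> * q $ i"
        using semifield_mult_left_mono[of _ _ ?\<alpha>] by (simp only: mult.assoc)
    qed
    then have "?K *v u \<le> (?\<alpha> * \<Delta>) *s q"
      by (simp add: less_eq_vec_def kernel_matrix_component)
    ultimately show ?thesis
      by blast
  qed
  ultimately show ?thesis
    by blast
qed

end
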